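(* Let $m$ be large and $J=\lfloor m^{1/2-\delta/5}\rfloor$, and put $x_j=\frac{j}{J}m$ for $0\le j\le J$. Let $\{\varphi_a\}_{a\in\Omega_m}$ be a family of $m$-periodic complex valued functions satisfying Assumptions 1 and 4. Then there exists a set $\mathcal{E}_m\subset\Omega_m$ with $|\mathcal{E}_m|\le m^{-\delta/10}|\Omega_m|$ such that for all $a\in\Omega_m\setminus\mathcal{E}_m$, $$\mathcal{M}(\varphi_a)=\max_{0\le j\le J-1}\left|\sum_{0\le n\le x_j}\varphi_a(n)\right|+O\left(m^{1/2-\delta/(8\alpha)}\right).$$
   Context: Let $m\ge2$ be an integer. For an $m$-periodic $\varphi:\mathbb{Z}\to\mathbb{C}$ put $\mathcal{M}(\varphi)=\max_{0\le x<m}\left|\sum_{0\le n\le x}\varphi(n)\right|$. A family $\{\varphi_a\}_{a\in\Omega_m}$ consists of a nonempty finite set $\Omega_m$ and $m$-periodic functions $\varphi_a$. "Absolute constant" means independent of $m$. Assumption 1: $\max_{a\in\Omega_m}\|\varphi_a\|_\infty\ll1$ with implied constant independent of $m$. Assumption 4: there are absolute constants $\alpha\ge1$ and $0<\delta<1/2$ such that for every interval $I$ of length $|I|\le m^{1/2+\delta}$, $\frac{1}{|\Omega_m|}\sum_{a\in\Omega_m}\left|\frac{1}{\sqrt m}\sum_{n\in I}\varphi_a(n)\right|^\alpha\ll m^{-1/2-\delta}$. The $\alpha,\delta$ in the claim are those of Assumption 4. *)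

theory Defs
  imports "HOL-Analysis.Analysis"
begin

definition periodic :: "nat \<Rightarrow> (int \<Rightarrow> complex) \<Rightarrow> bool" where
  "periodic m f \<longleftrightarrow> (\<forall>n. f (n + int m) = f n)"

definition partial_sum :: "(int \<Rightarrow> complex) \<Rightarrow> real \<Rightarrow> complex" where
  "partial_sum f x = (\<Sum>n | 0 \<le> n \<and> real_of_int n \<le> x. f n)"

definition max_partial_sum :: "nat \<Rightarrow> (int \<Rightarrow> complex) \<Rightarrow> real" where
  "max_partial_sum m f = Max ((\<lambda>x. norm (partial_sum f (real_of_int x))) ` {0..<int m})"

text \<open>The supremum is only used for periodic functions, whose range is finite.\<close>

definition sup_norm :: "(int \<Rightarrow> complex) \<Rightarrow> real" where
  "sup_norm f = (SUP n. norm (f n))"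

definition periodic_family :: "nat \<Rightarrow> 'a set \<Rightarrow> ('a \<Rightarrow> int \<Rightarrow> complex) \<Rightarrow> bool" where
  "periodic_family m \<Omega> \<phi> \<longleftrightarrow> m \<ge> 2 \<and> finite \<Omega> \<and> \<Omega> \<noteq> {} \<and> (\<forall>a\<in>\<Omega>. periodic m (\<phi> a))"

text \<open>In the next two definitions \<open>C\<close> is the implied constant of the estimate; it is a
  parameter so that independence of \<open>m\<close> can be expressed by quantifying \<open>C\<close> before \<open>m\<close>.\<close>

definition uniformly_bounded_family ::
    "real \<Rightarrow> 'a set \<Rightarrow> ('a \<Rightarrow> int \<Rightarrow> complex) \<Rightarrow> bool" where
  "uniformly_bounded_family C \<Omega> \<phi> \<longleftrightarrow> Max ((\<lambda>a. sup_norm (\<phi> a)) ` \<Omega>) \<le> C"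

text \<open>Intervals are intervals of integers and their length is the number of elements. An interval
  of \<open>k > 0\<close> consecutive integers also spans a real interval of length \<open>k - 1\<close>, so the condition
  below follows from the one that ranges over real intervals.\<close>

definition short_interval_moment_bound ::
    "real \<Rightarrow> real \<Rightarrow> real \<Rightarrow> nat \<Rightarrow> 'a set \<Rightarrow> ('a \<Rightarrow> int \<Rightarrow> complex) \<Rightarrow> bool" where
  "short_interval_moment_bound C \<alpha> \<delta> m \<Omega> \<phi> \<longleftrightarrow>
     (\<forall>u v :: int. real (card {u..v}) \<le> real m powr (1/2 + \<delta>) \<longrightarrow>
        1 / real (card \<Omega>) *
          (\<Sum>a\<in>\<Omega>. norm (complex_of_real (1 / sqrt (real m)) * (\<Sum>n\<in>{u..v}. \<phi> a n)) powr \<alpha>)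
        \<le> C * real m powr (-1/2 - \<delta>))"

definition num_points :: "real \<Rightarrow> nat \<Rightarrow> nat" where
  "num_points \<delta> m = nat \<lfloor>real m powr (1/2 - \<delta>/5)\<rfloor>"

definition sample_point :: "real \<Rightarrow> nat \<Rightarrow> nat \<Rightarrow> real" where
  "sample_point \<delta> m j = real j / real (num_points \<delta> m) * real m"

end

theory Submission
  imports Defs
begin

text \<open>Put \<open>T = m powr (1/2 - \<delta>/(8\<alpha>))\<close>. Consider only the endpoints that are multiples of
  \<open>H = \<lfloor>T\<rfloor>\<close>; there are \<open>O(m / T)\<close> of them. For each such endpoint \<open>y\<close> the interval from the last
  sample point before \<open>y\<close> up to \<open>y\<close> has length at most \<open>m powr (1/2 + \<delta>)\<close>, so Markov's inequality
  for the \<open>\<alpha>\<close>-th moment shows that its sum exceeds \<open>T\<close> for a proportion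
  \<open>O(m powr (-1/2 - \<delta> + \<delta>/8))\<close> of the parameters only. The union of these exceptional sets over all \<open>y\<close>
  has proportion \<open>O(m powr (-3\<delta>/4))\<close>. Outside of it, every partial sum differs from the one at
  the preceding sample point by at most \<open>T\<close> plus a trivially bounded sum of length at most \<open>H\<close>.\<close>

section \<open>Periodic functions and sums over integer intervals\<close>

lemma periodic_mod:
  assumes "periodic m f"
  shows "f (n mod int m) = f n"
proof -
  have mult: "f (x + int k * int m) = f x" for x k
  proof (induction k)
    case (Suc k)
    have "f (x + int (Suc k) * int m) = f ((x + int k * int m) + int m)"
      by (simp add: algebra_simps)
    then show ?case
      using Suc assms by (simp add: periodic_def)
  qed simp
  show ?thesis
  proof (cases "n div int m \<ge> 0")
    case True
    then show ?thesis
      using mult[of "n mod int m" "nat (n div int m)"] by simp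
  next
    case False
    then have "n mod int m = n + int (nat (- (n div int m))) * int m"
      by (simp add: minus_div_mult_eq_mod [symmetric])
    then show ?thesis
      using mult[of n "nat (- (n div int m))"] by simp
  qed
qed

text \<open>A real \<open>SUP\<close> dominates its members only if they are bounded above;
  periodicity makes the range the finite image of one period.\<close>

lemma norm_le_sup_norm:
  assumes "periodic m f" "m > 0"
  shows "norm (f n) \<le> sup_norm f"
proof -
  have "range (\<lambda>n. norm (f n)) \<subseteq> (\<lambda>n. norm (f n)) ` {0..<int m}"
  proof
    fix r assume "r \<in> range (\<lambda>n. norm (f n))"
    then obtain n where "r = norm (f n)" by auto
    then have "r = norm (f (n mod int m))"
      using periodic_mod[OF assms(1)] by simp
    then show "r \<in> (\<lambda>n. norm (f n)) ` {0..<int m}"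
      using assms(2) by auto
  qed
  then have "finite (range (\<lambda>n. norm (f n)))"
    by (rule finite_subset) simp
  then show ?thesis
    unfolding sup_norm_def by (intro cSUP_upper bdd_above_finite) auto
qed

lemma norm_sum_interval_le:
  fixes f :: "int \<Rightarrow> complex"
  assumes "\<And>n. norm (f n) \<le> C" "u \<le> v"
  shows "norm (\<Sum>n\<in>{u+1..v}. f n) \<le> C * real_of_int (v - u)"
proof -
  have "norm (\<Sum>n\<in>{u+1..v}. f n) \<le> (\<Sum>n\<in>{u+1..v}. C)"
    by (rule sum_norm_le) (use assms in auto)
  also have "\<dots> = C * real_of_int (v - u)"
    using assms(2) by simp
  finally show ?thesis .
qed

lemma partial_sum_floor: "partial_sum f x = (\<Sum>n\<in>{0..\<lfloor>x\<rfloor>}. f n)"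
  unfolding partial_sum_def by (rule sum.cong) (auto simp: le_floor_iff)

lemma sum_interval_split:
  fixes f :: "int \<Rightarrow> complex"
  assumes "u \<le> v + 1" "v \<le> w"
  shows "(\<Sum>n\<in>{u..w}. f n) = (\<Sum>n\<in>{u..v}. f n) + (\<Sum>n\<in>{v+1..w}. f n)"
proof -
  have "{u..w} = {u..v} \<union> {v+1..w}" using assms by auto
  then show ?thesis by (simp add: sum.union_disjoint)
qed

section \<open>The sample grid in integer arithmetic\<close>

text \<open>The integer part of the last of the points \<open>j m / J\<close> that does not exceed \<open>z\<close>.\<close>

definition grid_base :: "int \<Rightarrow> int \<Rightarrow> int \<Rightarrow> int" where
  "grid_base m J z = (z * J div m) * m div J"

lemma grid_base_le:
  assumes "m > 0" "J > 0"
  shows "grid_base m J z \<le> z"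
proof -
  have "(z * J div m) * m \<le> z * J"
    using div_mult_mod_eq[of "z * J" m] pos_mod_sign[OF assms(1), of "z * J"] by linarith
  then have "grid_base m J z \<le> z * J div J"
    unfolding grid_base_def using assms(2) by (rule zdiv_mono1)
  then show ?thesis using assms(2) by simp
qed

text \<open>Rounding the exact sample point down loses less than 1. Everything is multiplied by
  \<open>J\<close> to stay in the integers.\<close>

lemma less_grid_base_Suc:
  assumes "J > 0"
  shows "(z * J div m) * m < (grid_base m J z + 1) * J"
proof -
  have "(z * J div m) * m = grid_base m J z * J + (z * J div m) * m mod J"
    unfolding grid_base_def by simp
  moreover have "(z * J div m) * m mod J < J" using assms by simp
  ultimately show ?thesis by (simp add: algebra_simps)
qed

text \<open>Consecutive sample points are \<open>m / J\<close> apart; the subtracted 1 pays for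
  rounding the point down.\<close>

lemma grid_base_gap:
  assumes "m > 0" "J > 0"
  shows "(z - grid_base m J z - 1) * J < m"
proof -
  have "(z - grid_base m J z - 1) * J = z * J - (grid_base m J z + 1) * J"
    by (simp add: algebra_simps)
  then show ?thesis
    using less_grid_base_Suc[OF assms(2), of z m] div_mult_mod_eq[of "z * J" m]
      pos_mod_bound[OF assms(1), of "z * J"] by linarith
qed

text \<open>The exact sample point preceding \<open>x\<close> is less than
  \<open>grid_base m J x + 1\<close>, hence less than the integer \<open>y\<close>. So it also
  precedes \<open>y\<close>, and both have the same last sample point.\<close>

lemma grid_base_eq:
  assumes "m > 0" "J > 0" "grid_base m J x < y" "y \<le> x"
  shows "grid_base m J y = grid_base m J x"
proof -
  have "(x * J div m) * m \<le> (grid_base m J x + 1) * J"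
    using less_grid_base_Suc[OF assms(2), of x m] by simp
  also have "\<dots> \<le> y * J"
    using assms by (intro mult_right_mono) auto
  finally have "x * J div m \<le> y * J div m"
    using assms(1) zdiv_mono1[of "(x * J div m) * m" "y * J" m] by simp
  moreover have "y * J div m \<le> x * J div m"
    using assms by (intro zdiv_mono1 mult_right_mono) auto
  ultimately show ?thesis by (simp add: grid_base_def)
qed

text \<open>Reduces arbitrary endpoints to multiples of \<open>H\<close>, so that only few intervals
  need the moment bound. What remains after the last multiple of \<open>H\<close> is bounded
  trivially.\<close>

lemma norm_sum_from_grid_base_le:
  fixes f :: "int \<Rightarrow> complex"
  assumes pos: "m > 0" "J > 0" "H > 0" and C: "\<And>n. norm (f n) \<le> C"
    and T: "norm (\<Sum>n\<in>{grid_base m J (H * (x div H)) + 1..H * (x div H)}. f n) \<le> T"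
  shows "norm (\<Sum>n\<in>{grid_base m J x + 1..x}. f n) \<le> C * real_of_int H + T"
proof -
  define y where "y = H * (x div H)"
  define b where "b = grid_base m J x"
  have C0: "C \<ge> 0" using C[of 0] norm_ge_zero[of "f 0"] by linarith
  have T0: "T \<ge> 0" using T norm_ge_zero order_trans by blast
  have xy: "y \<le> x" "x - y \<le> H"
    using pos(3) mult_div_mod_eq[of H x] pos_mod_bound[of H x] pos_mod_sign[of H x]
    unfolding y_def by linarith+
  have bx: "b \<le> x" unfolding b_def using pos by (intro grid_base_le)
  show ?thesis
  proof (cases "b < y")
    \<comment> \<open>Here the base lies within \<open>H\<close> of \<open>x\<close>, so the trivial
      bound covers the entire sum.\<close>
    case False
    have "norm (\<Sum>n\<in>{b + 1..x}. f n) \<le> C * real_of_int (x - b)"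
      using C bx by (rule norm_sum_interval_le)
    also have "\<dots> \<le> C * real_of_int H"
      using False xy C0 by (intro mult_left_mono) linarith+
    finally show ?thesis using T0 unfolding b_def by linarith
  next
    case True
    \<comment> \<open>The sum controlled by the hypothesis thus starts at the same \<open>b\<close>
      as the sum up to \<open>x\<close>.\<close>
    have base_y: "grid_base m J y = b"
      unfolding b_def using pos True xy by (intro grid_base_eq) (auto simp: b_def)
    have "norm (\<Sum>n\<in>{y + 1..x}. f n) \<le> C * real_of_int (x - y)"
      using C xy(1) by (rule norm_sum_interval_le)
    also have "\<dots> \<le> C * real_of_int H"
      using xy C0 by (intro mult_left_mono) linarith+
    finally have 1: "norm (\<Sum>n\<in>{y + 1..x}. f n) \<le> C * real_of_int H" .
    have 2: "norm (\<Sum>n\<in>{b + 1..y}. f n) \<le> T"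
      using T by (simp flip: y_def add: base_y)
    have "(\<Sum>n\<in>{b + 1..x}. f n) = (\<Sum>n\<in>{b + 1..y}. f n) + (\<Sum>n\<in>{y + 1..x}. f n)"
      using True xy by (intro sum_interval_split) auto
    then show ?thesis
      using 1 2 norm_triangle_ineq[of "\<Sum>n\<in>{b + 1..y}. f n" "\<Sum>n\<in>{y + 1..x}. f n"]
      unfolding b_def by simp
  qed
qed

section \<open>Comparison of the full maximum with the sampled one\<close>

lemma floor_sample_point:
  "\<lfloor>sample_point \<delta> m j\<rfloor> = int j * int m div int (num_points \<delta> m)"
proof -
  have "sample_point \<delta> m j
      = real_of_int (int j * int m) / real_of_int (int (num_points \<delta> m))"
    by (simp add: sample_point_def)
  then show ?thesis by (simp only: floor_divide_of_int_eq)
qed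

lemma int_div_less_if_less_mult:
  fixes x m q :: int
  assumes "m > 0" "x < m * q"
  shows "x div m < q"
proof (rule ccontr)
  assume "\<not> x div m < q"
  then have "m * q \<le> m * (x div m)" using assms by simp
  then show False
    using assms mult_div_mod_eq[of m x] pos_mod_sign[OF assms(1), of x] by linarith
qed

text \<open>Each partial sum is the one at the preceding sample point plus an interval sum bounded
  by \<open>?R\<close>. Conversely, every sampled sum is itself a partial sum up to an integer in
  \<open>{0..<m}\<close>. The range of \<open>k\<close> contains \<open>x div H\<close> for all such
  \<open>x\<close>.\<close>

lemma max_partial_sum_grid:
  fixes f :: "int \<Rightarrow> complex" and m :: nat and \<delta> :: real
  defines "J \<equiv> num_points \<delta> m"
  assumes pos: "m > 0" "J > 0" "H > 0" and C: "\<And>n. norm (f n) \<le> C"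
    and T: "\<And>k. k \<in> {0..int m div H} \<Longrightarrow>
      norm (\<Sum>n\<in>{grid_base m J (H * k) + 1..H * k}. f n) \<le> T"
  shows "\<bar>max_partial_sum m f -
      Max ((\<lambda>j. norm (partial_sum f (sample_point \<delta> m j))) ` {..<J})\<bar> \<le> C * real_of_int H + T"
    (is "\<bar>?M - ?S\<bar> \<le> ?R")
proof -
  have upper: "norm (partial_sum f (real_of_int x)) \<le> ?S + ?R" if x: "x \<in> {0..<int m}" for x
  proof -
    \<comment> \<open>The index of the last sample point not exceeding \<open>x\<close>. Since
      \<open>x < m\<close>, it is below \<open>J\<close>, which is why the sampled maximum can stop
      at \<open>J - 1\<close>.\<close>
    define j where "j = nat (x * int J div int m)"
    define b where "b = grid_base m J x"
    have j: "int j = x * int J div int m"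
      using x pos unfolding j_def by (simp add: pos_imp_zdiv_nonneg_iff)
    have "x * int J div int m < int J"
      using x pos by (intro int_div_less_if_less_mult) (auto simp: mult.commute)
    then have jJ: "j < J" using j by linarith
    have fl: "\<lfloor>sample_point \<delta> m j\<rfloor> = b"
      unfolding floor_sample_point b_def grid_base_def j J_def by simp
    have "b \<ge> 0"
      unfolding b_def grid_base_def using pos x by (simp add: pos_imp_zdiv_nonneg_iff)
    moreover have "b \<le> x"
      unfolding b_def using pos by (intro grid_base_le) auto
    ultimately have "partial_sum f (real_of_int x)
        = partial_sum f (sample_point \<delta> m j) + (\<Sum>n\<in>{b + 1..x}. f n)"
      unfolding partial_sum_floor fl floor_of_int by (intro sum_interval_split) auto
    moreover have "norm (\<Sum>n\<in>{b + 1..x}. f n) \<le> ?R"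
      unfolding b_def using pos C x
      by (intro norm_sum_from_grid_base_le T) (auto simp: zdiv_mono1 pos_imp_zdiv_nonneg_iff)
    moreover have "norm (partial_sum f (sample_point \<delta> m j)) \<le> ?S"
      using jJ by (intro Max_ge) auto
    ultimately show ?thesis
      using norm_triangle_ineq[of "partial_sum f (sample_point \<delta> m j)" "\<Sum>n\<in>{b + 1..x}. f n"]
      by simp
  qed
  have "?M \<le> ?S + ?R"
    unfolding max_partial_sum_def using upper pos by (subst Max_le_iff) auto
  moreover have "?S \<le> ?M"
  proof (subst Max_le_iff)
    show "\<forall>r\<in>(\<lambda>j. norm (partial_sum f (sample_point \<delta> m j))) ` {..<J}. r \<le> ?M"
    proof clarify
      fix j assume "j < J"
      define x where "x = \<lfloor>sample_point \<delta> m j\<rfloor>"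
      have "int j * int m < int J * int m"
        using \<open>j < J\<close> pos by (simp add: mult.commute)
      then have "x < int m"
        unfolding x_def floor_sample_point J_def[symmetric] using pos
        by (intro int_div_less_if_less_mult) auto
      moreover have "x \<ge> 0"
        unfolding x_def floor_sample_point J_def[symmetric] using pos
        by (simp add: pos_imp_zdiv_nonneg_iff)
      moreover have "partial_sum f (sample_point \<delta> m j) = partial_sum f (real_of_int x)"
        by (simp add: partial_sum_floor x_def)
      ultimately show "norm (partial_sum f (sample_point \<delta> m j)) \<le> ?M"
        unfolding max_partial_sum_def by (intro Max_ge) auto
    qed
  qed (use pos in auto)
  \<comment> \<open>With this, \<open>?S \<le> ?M\<close> gives the other half of the absolute value
    bound. The index \<open>k = 0\<close> is always in range and yields
    \<open>T \<ge> 0\<close>.\<close>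
  moreover have "?R \<ge> 0"
  proof -
    have "C \<ge> 0" using C[of 0] norm_ge_zero[of "f 0"] by linarith
    moreover have "T \<ge> 0"
      using order_trans[OF norm_ge_zero T[of 0]] pos by (simp add: pos_imp_zdiv_nonneg_iff)
    ultimately show ?thesis using pos by simp
  qed
  ultimately show ?thesis by linarith
qed

section \<open>Markov's inequality and the exceptional parameters\<close>

lemma card_large_values_le:
  fixes g :: "'a \<Rightarrow> real"
  assumes "finite A" "t > 0" "\<alpha> > 0"
  shows "real (card {a\<in>A. g a > t}) * t powr \<alpha> \<le> (\<Sum>a\<in>A. g a powr \<alpha>)"
proof -
  have "real (card {a\<in>A. g a > t}) * t powr \<alpha> = (\<Sum>a\<in>{a\<in>A. g a > t}. t powr \<alpha>)" by simp
  also have "\<dots> \<le> (\<Sum>a\<in>{a\<in>A. g a > t}. g a powr \<alpha>)"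
    using assms by (intro sum_mono powr_mono2) auto
  also have "\<dots> \<le> (\<Sum>a\<in>A. g a powr \<alpha>)"
    using assms by (intro sum_mono2) auto
  finally show ?thesis .
qed

text \<open>After division by \<open>sqrt m\<close> the threshold becomes
  \<open>t = m powr (-\<delta>/(8*\<alpha>))\<close>, and
  \<open>t powr \<alpha> = m powr (-\<delta>/8)\<close>. Markov's inequality therefore loses only
  the factor \<open>m powr (\<delta>/8)\<close>, whatever \<open>\<alpha>\<close> is.\<close>

lemma short_interval_exceptions:
  fixes \<phi> :: "'a \<Rightarrow> int \<Rightarrow> complex"
  assumes mom: "short_interval_moment_bound C \<alpha> \<delta> m \<Omega> \<phi>"
    and \<Omega>: "finite \<Omega>" "\<Omega> \<noteq> {}" and "m > 0" "\<alpha> \<ge> 1"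
    and len: "real (card {u..v}) \<le> real m powr (1/2 + \<delta>)"
  shows "real (card {a\<in>\<Omega>. norm (\<Sum>n\<in>{u..v}. \<phi> a n) > real m powr (1/2 - \<delta>/(8*\<alpha>))})
    \<le> C * real m powr (-1/2 - \<delta> + \<delta>/8) * real (card \<Omega>)"
proof -
  define t where "t = real m powr (- \<delta>/(8*\<alpha>))"
  define S where "S a = (\<Sum>n\<in>{u..v}. \<phi> a n)" for a
  define g where "g a = norm (complex_of_real (1 / sqrt (real m)) * S a)" for a
  have g: "g a = norm (S a) / sqrt (real m)" for a
    by (simp add: g_def norm_divide)
  have "real m powr (1/2 - \<delta>/(8*\<alpha>)) = t * sqrt (real m)"
    unfolding t_def using \<open>m > 0\<close> by (simp add: powr_half_sqrt [symmetric] flip: powr_add)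
  then have bad: "{a\<in>\<Omega>. norm (S a) > real m powr (1/2 - \<delta>/(8*\<alpha>))} = {a\<in>\<Omega>. g a > t}"
    using \<open>m > 0\<close> by (auto simp: g field_simps)
  have card: "real (card \<Omega>) > 0" using \<Omega> by (simp add: card_gt_0_iff)
  have t\<alpha>: "t powr \<alpha> = real m powr (-\<delta>/8)"
    unfolding t_def using \<open>\<alpha> \<ge> 1\<close> by (simp add: powr_powr)
  have "real (card {a\<in>\<Omega>. g a > t}) * t powr \<alpha> \<le> (\<Sum>a\<in>\<Omega>. g a powr \<alpha>)"
    using \<Omega> \<open>m > 0\<close> \<open>\<alpha> \<ge> 1\<close> by (intro card_large_values_le) (auto simp: t_def)
  also have "\<dots> \<le> C * real m powr (-1/2 - \<delta>) * real (card \<Omega>)"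
    using mom len card unfolding short_interval_moment_bound_def g_def S_def
    by (auto simp: field_simps)
  finally have "real (card {a\<in>\<Omega>. g a > t}) * real m powr (-\<delta>/8) * real m powr (\<delta>/8)
      \<le> C * real m powr (-1/2 - \<delta>) * real (card \<Omega>) * real m powr (\<delta>/8)"
    unfolding t\<alpha> by (rule mult_right_mono) simp
  moreover have "real m powr (-\<delta>/8) * real m powr (\<delta>/8) = 1"
    using \<open>m > 0\<close> by (simp flip: powr_add)
  moreover have "real m powr (-1/2 - \<delta>) * real m powr (\<delta>/8) = real m powr (-1/2 - \<delta> + \<delta>/8)"
    by (simp flip: powr_add)
  ultimately show ?thesis
    unfolding S_def[symmetric] bad by (simp add: mult.assoc) (simp add: mult_ac)
qed

section \<open>Estimates for large arguments\<close>

lemma eventually_powr_ge: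
  assumes "c > 0"
  shows "\<forall>\<^sub>F m in sequentially. real m powr c \<ge> B"
proof -
  \<comment> \<open>Taking \<open>max 1 B\<close> keeps the base of the root positive for every real
    \<open>B\<close>.\<close>
  have "\<forall>\<^sub>F m in sequentially. real m \<ge> max 1 B powr (1 / c)"
    using filterlim_real_sequentially by (simp add: filterlim_at_top)
  then show ?thesis
  proof eventually_elim
    case (elim m)
    have "B \<le> (max 1 B powr (1 / c)) powr c"
      using assms by (simp add: powr_powr)
    also have "\<dots> \<le> real m powr c"
      using elim assms by (intro powr_mono2) auto
    finally show ?case .
  qed
qed

lemma half_le_of_int_floor:
  fixes x :: real
  assumes "x \<ge> 1"
  shows "x / 2 \<le> of_int \<lfloor>x\<rfloor>"
proof -
  have "of_int \<lfloor>x\<rfloor> \<ge> (1::real)" using assms by simp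
  then show ?thesis by linarith
qed

section \<open>Choice of parameters and the union bound\<close>

theorem theorem2p3:
  fixes \<alpha> \<delta> C\<^sub>1 C\<^sub>4 :: real
  assumes "\<alpha> \<ge> 1" and "0 < \<delta>" and "\<delta> < 1/2"
  shows "\<exists>K. \<forall>\<^sub>F m in sequentially. \<forall>(\<Omega> :: 'a set) \<phi>.
    periodic_family m \<Omega> \<phi> \<longrightarrow>
    uniformly_bounded_family C\<^sub>1 \<Omega> \<phi> \<longrightarrow>
    short_interval_moment_bound C\<^sub>4 \<alpha> \<delta> m \<Omega> \<phi> \<longrightarrow>
    (\<exists>E \<subseteq> \<Omega>. real (card E) \<le> real m powr (- \<delta>/10) * real (card \<Omega>) \<and>
      (\<forall>a \<in> \<Omega> - E.
        \<bar>max_partial_sum m (\<phi> a) -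
          Max ((\<lambda>j. norm (partial_sum (\<phi> a) (sample_point \<delta> m j))) ` {..<num_points \<delta> m})\<bar>
        \<le> K * real m powr (1/2 - \<delta> / (8 * \<alpha>))))"
proof (rule exI[of _ "C\<^sub>1 + 1"])
  have \<delta>\<alpha>: "\<delta> / (8 * \<alpha>) \<le> \<delta> / 8" "\<delta> / (8 * \<alpha>) > 0"
    using assms by (auto simp: field_simps)
  \<comment> \<open>The exponents are the available slack: \<open>4*\<delta>/5\<close> separates the
    grid spacing \<open>m powr (1/2 + \<delta>/5)\<close> from the admissible length
    \<open>m powr (1/2 + \<delta>)\<close>, and
    \<open>13*\<delta>/20 = 3*\<delta>/4 - \<delta>/10\<close> separates the union bound from the
    claimed proportion.\<close>
  have "\<forall>\<^sub>F m in sequentially. real m powr (4*\<delta>/5) \<ge> 3"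
    "\<forall>\<^sub>F m in sequentially. real m powr (13*\<delta>/20) \<ge> 3 * \<bar>C\<^sub>4\<bar>"
    using assms by (auto intro!: eventually_powr_ge)
  moreover have "\<forall>\<^sub>F m::nat in sequentially. m \<ge> 2" by (rule eventually_ge_at_top)
  ultimately show "\<forall>\<^sub>F m in sequentially. \<forall>(\<Omega> :: 'a set) \<phi>.
    periodic_family m \<Omega> \<phi> \<longrightarrow>
    uniformly_bounded_family C\<^sub>1 \<Omega> \<phi> \<longrightarrow>
    short_interval_moment_bound C\<^sub>4 \<alpha> \<delta> m \<Omega> \<phi> \<longrightarrow>
    (\<exists>E \<subseteq> \<Omega>. real (card E) \<le> real m powr (- \<delta>/10) * real (card \<Omega>) \<and>
      (\<forall>a \<in> \<Omega> - E.
        \<bar>max_partial_sum m (\<phi> a) -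
          Max ((\<lambda>j. norm (partial_sum (\<phi> a) (sample_point \<delta> m j))) ` {..<num_points \<delta> m})\<bar>
        \<le> (C\<^sub>1 + 1) * real m powr (1/2 - \<delta> / (8 * \<alpha>))))"
  proof eventually_elim
    case (elim m)
    note large = elim(1,2)
    have m: "m > 0" "real m \<ge> 1" using elim(3) by auto
    define T where "T = real m powr (1/2 - \<delta> / (8 * \<alpha>))"
    define H where "H = \<lfloor>T\<rfloor>"
    define J where "J = num_points \<delta> m"
    have T1: "T \<ge> 1"
      unfolding T_def using m \<delta>\<alpha> assms by (intro ge_one_powr_ge_zero) auto
    \<comment> \<open>The lower bound on \<open>H\<close> limits the number of endpoints; the upper
      bound limits the trivially estimated piece.\<close>
    have H: "H > 0" "T / 2 \<le> real_of_int H" "real_of_int H \<le> T"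
      using T1 half_le_of_int_floor[OF T1] unfolding H_def by auto
    have P1: "real m powr (1/2 - \<delta>/5) \<ge> 1"
      using m assms by (intro ge_one_powr_ge_zero) auto
    have realJ: "real J = of_int \<lfloor>real m powr (1/2 - \<delta>/5)\<rfloor>"
      using P1 by (simp add: J_def num_points_def)
    have Jhalf: "real m powr (1/2 - \<delta>/5) / 2 \<le> real J"
      unfolding realJ using P1 by (rule half_le_of_int_floor)
    have J0: "J > 0" using Jhalf P1 by (cases J) auto
    have len: "real (card {grid_base m J z + 1..z}) \<le> real m powr (1/2 + \<delta>)" for z
    proof -
      have "real_of_int ((z - grid_base m J z - 1) * J) < real m"
        using grid_base_gap[of m J z] m J0 by linarith
      then have "real_of_int (z - grid_base m J z - 1) < real m / real J"
        using J0 by (simp add: field_simps)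
      also have "\<dots> \<le> real m / (real m powr (1/2 - \<delta>/5) / 2)"
        using Jhalf P1 J0 m by (intro divide_left_mono mult_pos_pos) auto
      also have "\<dots> = 2 * (real m powr 1 / real m powr (1/2 - \<delta>/5))"
        using m by simp
      also have "\<dots> = 2 * real m powr (1/2 + \<delta>/5)"
        by (simp only: powr_diff [symmetric]) (simp add: algebra_simps)
      \<comment> \<open>The 1 is the rounding loss; it is absorbed into a third copy of the
        power.\<close>
      finally have "real_of_int (z - grid_base m J z) \<le> 2 * real m powr (1/2 + \<delta>/5) + 1"
        by simp
      also have "\<dots> \<le> 3 * real m powr (1/2 + \<delta>/5)"
        using ge_one_powr_ge_zero[of "real m" "1/2 + \<delta>/5"] m assms by simp
      also have "\<dots> \<le> real m powr (4*\<delta>/5) * real m powr (1/2 + \<delta>/5)"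
        using large(1) by (intro mult_right_mono) auto
      also have "\<dots> = real m powr (1/2 + \<delta>)"
        by (simp only: powr_add [symmetric]) (simp add: algebra_simps)
      finally show ?thesis
        using grid_base_le[of m J z] m J0 by simp
    qed
    show ?case
    proof (intro allI impI)
      fix \<Omega> :: "'a set" and \<phi>
      assume fam: "periodic_family m \<Omega> \<phi>" and bdd: "uniformly_bounded_family C\<^sub>1 \<Omega> \<phi>"
        and mom: "short_interval_moment_bound C\<^sub>4 \<alpha> \<delta> m \<Omega> \<phi>"
      have \<Omega>: "finite \<Omega>" "\<Omega> \<noteq> {}" using fam by (auto simp: periodic_family_def)
      have C1: "norm (\<phi> a n) \<le> C\<^sub>1" if "a \<in> \<Omega>" for a n
      proof -
        have "norm (\<phi> a n) \<le> sup_norm (\<phi> a)"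
          using fam that m by (intro norm_le_sup_norm[of m]) (auto simp: periodic_family_def)
        also have "\<dots> \<le> C\<^sub>1"
          using bdd \<Omega> that by (auto simp: uniformly_bounded_family_def)
        finally show ?thesis .
      qed
      define B where
        "B k = {a\<in>\<Omega>. norm (\<Sum>n\<in>{grid_base m J (H * k) + 1..H * k}. \<phi> a n) > T}" for k
      define E where "E = (\<Union>k\<in>{0..int m div H}. B k)"
      \<comment> \<open>No sign of \<open>C\<^sub>4\<close> is given; the absolute value makes the
        bound nonnegative, so that it can be multiplied by the estimate
        \<open>count\<close>.\<close>
      have B: "real (card (B k)) \<le> \<bar>C\<^sub>4\<bar> * real m powr (-1/2 - \<delta> + \<delta>/8) * real (card \<Omega>)" for k
      proof -
        have "real (card (B k)) \<le> C\<^sub>4 * real m powr (-1/2 - \<delta> + \<delta>/8) * real (card \<Omega>)"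
          unfolding B_def T_def using mom \<Omega> m assms len
          by (intro short_interval_exceptions) auto
        also have "\<dots> \<le> \<bar>C\<^sub>4\<bar> * real m powr (-1/2 - \<delta> + \<delta>/8) * real (card \<Omega>)"
          by (intro mult_right_mono) auto
        finally show ?thesis .
      qed
      \<comment> \<open>The exponent \<open>1/2 + \<delta>/(8*\<alpha>)\<close> of
        \<open>m / T\<close> is at most \<open>1/2 + \<delta>/8\<close> because
        \<open>\<alpha> \<ge> 1\<close>.\<close>
      have count: "real (card {0..int m div H}) \<le> 3 * real m powr (1/2 + \<delta>/8)"
      proof -
        have "real (card {0..int m div H}) = real_of_int (int m div H) + 1"
          using H m by (simp add: pos_imp_zdiv_nonneg_iff)
        also have "\<dots> \<le> real m / real_of_int H + 1"
          using real_of_int_div4[of "int m" H] by simp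
        also have "\<dots> \<le> real m / (T / 2) + 1"
          using H T1 by (intro add_right_mono divide_left_mono) auto
        also have "\<dots> = 2 * (real m powr 1 / T) + 1"
          using m by simp
        also have "\<dots> = 2 * real m powr (1/2 + \<delta>/(8*\<alpha>)) + 1"
          unfolding T_def by (simp only: powr_diff [symmetric]) (simp add: algebra_simps)
        also have "\<dots> \<le> 3 * real m powr (1/2 + \<delta>/(8*\<alpha>))"
          using ge_one_powr_ge_zero[of "real m" "1/2 + \<delta>/(8*\<alpha>)"] m \<delta>\<alpha> by simp
        also have "\<dots> \<le> 3 * real m powr (1/2 + \<delta>/8)"
          using m \<delta>\<alpha> by (intro mult_left_mono powr_mono) auto
        finally show ?thesis .
      qed
      have "real (card E) \<le> (\<Sum>k\<in>{0..int m div H}. real (card (B k)))"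
        unfolding E_def of_nat_sum[symmetric] of_nat_le_iff by (rule card_UN_le) simp
      also have "\<dots> \<le> (\<Sum>k\<in>{0..int m div H}.
          \<bar>C\<^sub>4\<bar> * real m powr (-1/2 - \<delta> + \<delta>/8) * real (card \<Omega>))"
        by (intro sum_mono B)
      also have "\<dots> = real (card {0..int m div H})
          * (\<bar>C\<^sub>4\<bar> * real m powr (-1/2 - \<delta> + \<delta>/8) * real (card \<Omega>))"
        by (simp only: sum_constant)
      also have "\<dots> \<le> 3 * real m powr (1/2 + \<delta>/8)
          * (\<bar>C\<^sub>4\<bar> * real m powr (-1/2 - \<delta> + \<delta>/8) * real (card \<Omega>))"
        by (intro mult_right_mono count) auto
      also have "\<dots> = 3 * \<bar>C\<^sub>4\<bar>
          * (real m powr (1/2 + \<delta>/8) * real m powr (-1/2 - \<delta> + \<delta>/8)) * real (card \<Omega>)"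
        by (simp only: mult_ac)
      \<comment> \<open>The halves cancel, leaving
        \<open>\<delta>/8 - \<delta> + \<delta>/8 = -3*\<delta>/4\<close>.\<close>
      also have "\<dots> = 3 * \<bar>C\<^sub>4\<bar> * real m powr (-3*\<delta>/4) * real (card \<Omega>)"
        by (simp only: powr_add [symmetric]) (simp add: algebra_simps)
      also have "\<dots> \<le> real m powr (13*\<delta>/20) * real m powr (-3*\<delta>/4) * real (card \<Omega>)"
        by (intro mult_right_mono large) auto
      also have "\<dots> = real m powr (- \<delta>/10) * real (card \<Omega>)"
        by (simp only: powr_add [symmetric]) (simp add: algebra_simps)
      finally have cardE: "real (card E) \<le> real m powr (- \<delta>/10) * real (card \<Omega>)" .
      have "\<bar>max_partial_sum m (\<phi> a) -
          Max ((\<lambda>j. norm (partial_sum (\<phi> a) (sample_point \<delta> m j))) ` {..<num_points \<delta> m})\<bar>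
        \<le> (C\<^sub>1 + 1) * T" if a: "a \<in> \<Omega> - E" for a
      proof -
        have "\<bar>max_partial_sum m (\<phi> a) -
            Max ((\<lambda>j. norm (partial_sum (\<phi> a) (sample_point \<delta> m j))) ` {..<num_points \<delta> m})\<bar>
          \<le> C\<^sub>1 * real_of_int H + T"
        proof (rule max_partial_sum_grid)
          show "norm (\<Sum>n\<in>{grid_base m (num_points \<delta> m) (H * k) + 1..H * k}. \<phi> a n) \<le> T"
            if "k \<in> {0..int m div H}" for k
            using a that by (force simp: E_def B_def J_def)
        qed (use a m J0 H C1 in \<open>auto simp: J_def\<close>)
        \<comment> \<open>This is the source of the constant \<open>C\<^sub>1 + 1\<close>. That
          \<open>C\<^sub>1\<close> is nonnegative follows from its bounding a norm.\<close>
        also have "\<dots> \<le> C\<^sub>1 * T + T"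
        proof -
          have "C\<^sub>1 \<ge> 0" using C1[of a 0] a norm_ge_zero order_trans by blast
          then show ?thesis using H(3) by (simp add: mult_left_mono)
        qed
        finally show ?thesis by (simp add: algebra_simps)
      qed
      moreover have "E \<subseteq> \<Omega>" by (auto simp: E_def B_def)
      ultimately show "\<exists>E \<subseteq> \<Omega>. real (card E) \<le> real m powr (- \<delta>/10) * real (card \<Omega>) \<and>
        (\<forall>a \<in> \<Omega> - E.
          \<bar>max_partial_sum m (\<phi> a) -
            Max ((\<lambda>j. norm (partial_sum (\<phi> a) (sample_point \<delta> m j))) ` {..<num_points \<delta> m})\<bar>
          \<le> (C\<^sub>1 + 1) * real m powr (1/2 - \<delta> / (8 * \<alpha>)))"
        using cardE unfolding T_def by blast
    qed
  qed
qed

end
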